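(* Let $k\ge 3$ be an integer. There are no excluded minors for $\mathcal{P}_{U_{2,4}}^k$ on a ground set of size $3$.
   Context: A polymatroid is a pair $(E,\rho)$ where $E$ is a finite set and $\rho:2^E\to\mathbb{Z}$ satisfies $\rho(\emptyset)=0$, monotonicity and submodularity ($\rho(A)+\rho(B)\ge\rho(A\cap B)+\rho(A\cup B)$). For an integer $k\ge 1$, a $k$-polymatroid is a polymatroid with $\rho(\{e\})\le k$ for all $e\in E$. For $X\subseteq E$, the deletion $\rho\backslash X$ and contraction $\rho/X$ are the polymatroids on $E-X$ given by $(\rho\backslash X)(Y)=\rho(Y)$ and $(\rho/X)(Y)=\rho(X\cup Y)-\rho(X)$. A minor of $\rho$ is a polymatroid $(\rho\backslash X)/Y$ with $X,Y\subseteq E$ disjoint; it is proper if $X\cup Y\ne\emptyset$. The $k$-natural matroid $M_\rho^k$ of a $k$-polymatroid $(E,\rho)$: for each $e\in E$ let $X_e$ be a set of $k$ elements, with $X_e\cap X_f=\emptyset$ for $e\neq f$; for $A\subseteq E$ let $X_A=\bigcup_{e\in A}X_e$. Then $M_\rho^k$ is the matroid on $X_E$ with rank function $r(X)=\min\{\rho(A)+|X-X_A| : A\subseteq E\}$. $\mathcal{P}_{U_{2,4}}^k$ denotes the class of $k$-polymatroids whose $k$-natural matroid is binary (representable over $\mathbb{F}_2$). An excluded minor for $\mathcal{P}_{U_{2,4}}^k$ is a $k$-polymatroid that is not in $\mathcal{P}_{U_{2,4}}^k$ but all of whose proper minors are in $\mathcal{P}_{U_{2,4}}^k$. *)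

theory Defs
  imports Complex_Main "HOL-Library.Z2" "HOL-Library.Function_Algebras"
begin

(* Polymatroids and matroids are pairs of a ground set and a rank function. The rank function
   is a total HOL function, but only its values on subsets of the ground set are meaningful. *)

type_synonym 'a ranked_set = "'a set \<times> ('a set \<Rightarrow> int)"

definition polymatroid :: "'a ranked_set \<Rightarrow> bool" where
  "polymatroid P \<longleftrightarrow> (case P of (E, \<rho>) \<Rightarrow>
     finite E \<and> \<rho> {} = 0 \<and>
     (\<forall>A B. A \<subseteq> B \<and> B \<subseteq> E \<longrightarrow> \<rho> A \<le> \<rho> B) \<and>
     (\<forall>A B. A \<subseteq> E \<and> B \<subseteq> E \<longrightarrow> \<rho> A + \<rho> B \<ge> \<rho> (A \<inter> B) + \<rho> (A \<union> B)))"

definition k_polymatroid :: "nat \<Rightarrow> 'a ranked_set \<Rightarrow> bool" where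
  "k_polymatroid k P \<longleftrightarrow> polymatroid P \<and> (\<forall>e \<in> fst P. snd P {e} \<le> int k)"

definition deletion :: "'a ranked_set \<Rightarrow> 'a set \<Rightarrow> 'a ranked_set" where
  "deletion P X = (case P of (E, \<rho>) \<Rightarrow> (E - X, \<rho>))"

definition contraction :: "'a ranked_set \<Rightarrow> 'a set \<Rightarrow> 'a ranked_set" where
  "contraction P X = (case P of (E, \<rho>) \<Rightarrow> (E - X, \<lambda>Y. \<rho> (X \<union> Y) - \<rho> X))"

definition proper_minor :: "'a ranked_set \<Rightarrow> 'a ranked_set \<Rightarrow> bool" where
  "proper_minor N P \<longleftrightarrow> (\<exists>X Y. X \<subseteq> fst P \<and> Y \<subseteq> fst P \<and> X \<inter> Y = {} \<and> X \<union> Y \<noteq> {} \<and>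
     N = contraction (deletion P X) Y)"

(* The k-element set attached to e is {e} \<times> {..<k}, so the one attached to A is A \<times> {..<k}. *)

definition natural_matroid :: "nat \<Rightarrow> 'a ranked_set \<Rightarrow> ('a \<times> nat) ranked_set" where
  "natural_matroid k P = (case P of (E, \<rho>) \<Rightarrow>
     (E \<times> {..<k}, \<lambda>X. Min ((\<lambda>A. \<rho> A + int (card (X - A \<times> {..<k}))) ` Pow E)))"

(* The vector space of sequences over a field. It contains every finite-dimensional coordinate
   space, and a finite matroid only involves finitely many vectors, so maps into it suffice to
   express representability. *)

definition seq_scale :: "'f::field \<Rightarrow> (nat \<Rightarrow> 'f) \<Rightarrow> (nat \<Rightarrow> 'f)" where
  "seq_scale c v = (\<lambda>i. c * v i)"

interpretation seq_space: vector_space "seq_scale :: 'f::field \<Rightarrow> (nat \<Rightarrow> 'f) \<Rightarrow> (nat \<Rightarrow> 'f)"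
  by unfold_locales (auto simp: seq_scale_def fun_eq_iff algebra_simps)

(* \<phi> need not be injective: loops map to 0, and parallel elements may share a vector. *)

definition represents :: "('b \<Rightarrow> nat \<Rightarrow> 'f::field) \<Rightarrow> 'b ranked_set \<Rightarrow> bool" where
  "represents \<phi> M \<longleftrightarrow> (\<forall>X. X \<subseteq> fst M \<longrightarrow> snd M X = int (seq_space.dim (\<phi> ` X)))"

definition binary :: "'b ranked_set \<Rightarrow> bool" where
  "binary M \<longleftrightarrow> (\<exists>\<phi> :: 'b \<Rightarrow> nat \<Rightarrow> bit. represents \<phi> M)"

definition P_U24 :: "nat \<Rightarrow> 'a ranked_set set" where
  "P_U24 k = {P. k_polymatroid k P \<and> binary (natural_matroid k P)}"

definition excluded_minor :: "nat \<Rightarrow> 'a ranked_set \<Rightarrow> bool" where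
  "excluded_minor k P \<longleftrightarrow> k_polymatroid k P \<and> P \<notin> P_U24 k \<and>
     (\<forall>N. proper_minor N P \<longrightarrow> N \<in> P_U24 k)"

end

theory Submission
  imports Defs
begin

text \<open>
  For \<^term>\<open>k \<ge> (3::nat)\<close>, a binary natural matroid leaves very little freedom. The \<open>k\<close> elements
  attached to \<open>e\<close> are clones: exchanging two of them preserves the rank function. Over the
  two-element field a vector in the span of a finite set is the sum of a subset of it, and if the
  subset is minimal then the sum has to run over all of it. Two clones admit the same minimal
  subsets, so as soon as one clone lies in the closure of a set avoiding both, the two have equal
  vectors (\<open>clones_in_closure_same_vector\<close>). Consequently the elements attached to \<open>e\<close> are loops
  or parallel when \<open>\<rho> {e} \<le> 1\<close>, and otherwise removing two of them costs rank, which forces the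
  marginal of \<open>e\<close> over the rest of the ground set to be at least \<open>k - 1\<close>
  (\<open>binary_natural_matroid_large_marginal\<close>).

  Let now \<open>\<rho>\<close> be an excluded minor on at least three elements, let \<open>S\<close> be the set of all \<open>e\<close> with
  \<open>\<rho> {e} \<ge> 2\<close>, and put \<open>\<sigma> A = \<rho> A - (k - 1) * card (A \<inter> S)\<close>. The marginal condition, applied
  first to a deletion onto two elements and then to the contraction by one of them, shows that every
  element of \<open>S\<close> has marginal at least \<open>k - 1\<close> over everything else. This says that \<open>\<sigma>\<close> is
  monotone, and hence that it is the rank function of a matroid
  (\<open>excluded_minor_reduces_to_matroid\<close>).

  On three elements every matroid is binary (\<open>matroid_card_le_3_binary\<close>). The natural matroid of
  \<open>\<rho>\<close> arises from the matroid of \<open>\<sigma>\<close> by replacing each \<open>e\<close> in \<open>S\<close> with a series class of size \<open>k\<close>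
  and every other element with a parallel class of size \<open>k\<close>. These operations preserve binary
  representability (\<open>binary_natural_matroid_of_binary\<close>), so \<open>\<rho>\<close> is not an excluded minor after all.
\<close>

section \<open>Linear algebra over the two-element field\<close>

lemma sum_fun_apply: "(\<Sum>x\<in>A. f x) i = (\<Sum>x\<in>A. f x i)"
  by (induction A rule: infinite_finite_induct) auto

lemma bit_vector_add_self [simp]: "v + v = (0 :: nat \<Rightarrow> bit)"
proof
  fix i show "(v + v) i = 0 i" by (cases "v i") auto
qed

lemma bit_vector_diff: "v - w = v + (w :: nat \<Rightarrow> bit)"
proof
  fix i show "(v - w) i = (v + w) i" by (cases "v i"; cases "w i") auto
qed

lemma bit_vector_add_eq_0: "v + w = 0 \<longleftrightarrow> v = (w :: nat \<Rightarrow> bit)"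
  using eq_iff_diff_eq_0[of v w] by (simp only: bit_vector_diff)

text \<open>
  The only coefficients are 0 and 1, so a linear combination is the sum of the vectors that occur in
  it. This replaces linear combinations by finite sets throughout.
\<close>

lemma span_bit_subset_sum:
  fixes \<phi> :: "'b \<Rightarrow> nat \<Rightarrow> bit"
  assumes "finite A" and "v \<in> seq_space.span (\<phi> ` A)"
  shows "\<exists>B\<subseteq>A. v = sum \<phi> B"
  using assms
proof (induction A arbitrary: v rule: finite_induct)
  case empty
  then show ?case by auto
next
  case (insert a A)
  obtain c where c: "v - seq_scale c (\<phi> a) \<in> seq_space.span (\<phi> ` A)"
    using insert.prems by (auto simp: seq_space.span_insert)
  then obtain B where B: "B \<subseteq> A" "v - seq_scale c (\<phi> a) = sum \<phi> B"
    using insert.IH by blast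
  have fin: "finite B" "a \<notin> B" using B insert.hyps finite_subset by auto
  have v: "v = seq_scale c (\<phi> a) + sum \<phi> B" using B(2) by (simp add: algebra_simps)
  show ?case
  proof (cases "c = 0")
    case True
    then have "v = sum \<phi> B" using v by (simp add: seq_scale_def fun_eq_iff)
    then show ?thesis using B by blast
  next
    case False
    then have "seq_scale c (\<phi> a) = \<phi> a" by (simp add: seq_scale_def del: mult_bit_eq_and)
    then have "v = sum \<phi> (insert a B)" using v fin by simp
    then show ?thesis using B by blast
  qed
qed

lemma dim_finite_basis:
  fixes A :: "(nat \<Rightarrow> 'f::field) set"
  assumes "finite A"
  obtains B where "B \<subseteq> A" "seq_space.independent B" "seq_space.span B = seq_space.span A"
    "card B = seq_space.dim A"
proof -
  obtain B where "B \<subseteq> A" "seq_space.independent B" "A \<subseteq> seq_space.span B" "card B = seq_space.dim A"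
    using seq_space.basis_exists by metis
  then show thesis
    using that seq_space.span_eq seq_space.span_superset subset_trans by metis
qed

lemma dim_insert_in_span:
  "v \<in> seq_space.span A \<Longrightarrow> seq_space.dim (insert v A) = seq_space.dim A"
  by (metis seq_space.dim_span seq_space.span_redundant)

lemma dim_insert_notin_span:
  fixes A :: "(nat \<Rightarrow> 'f::field) set"
  assumes "finite A" "v \<notin> seq_space.span A"
  shows "seq_space.dim (insert v A) = Suc (seq_space.dim A)"
proof -
  obtain B where B: "B \<subseteq> A" "seq_space.independent B" "seq_space.span B = seq_space.span A"
    "card B = seq_space.dim A"
    using dim_finite_basis[OF assms(1)] .
  have "seq_space.independent (insert v B)"
    using B assms seq_space.independent_insertI by blast
  moreover have "seq_space.span (insert v B) = seq_space.span (insert v A)"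
    using B(3) by (simp add: seq_space.span_insert)
  ultimately have "seq_space.dim (insert v A) = card (insert v B)"
    by (metis seq_space.dim_eq_card)
  moreover have "v \<notin> B" using assms B seq_space.span_base by blast
  ultimately show ?thesis using B assms finite_subset by (metis card_insert_disjoint)
qed

lemma dim_insert_eq_iff:
  fixes A :: "(nat \<Rightarrow> 'f::field) set"
  assumes "finite A"
  shows "seq_space.dim (insert v A) = seq_space.dim A \<longleftrightarrow> v \<in> seq_space.span A"
  using dim_insert_in_span dim_insert_notin_span[OF assms] by fastforce

lemma dim_mono_finite:
  fixes A :: "(nat \<Rightarrow> 'f::field) set"
  assumes "finite A" "B \<subseteq> A"
  shows "seq_space.dim B \<le> seq_space.dim A"
proof -
  have finB: "finite B" using assms finite_subset by blast
  obtain A' where A': "A' \<subseteq> A" "seq_space.span A' = seq_space.span A" "card A' = seq_space.dim A"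
    using dim_finite_basis[OF assms(1)] by metis
  have "B \<subseteq> seq_space.span A'" using A'(2) assms seq_space.span_superset by blast
  then show ?thesis using seq_space.dim_le_card[of B A'] A' assms finite_subset by metis
qed

text \<open>
  Linear independence over the two-element field of a family of vectors, stated for the indices
  rather than for the set of vectors: a repeated vector counts as a dependency.
\<close>

definition zero_sum_free :: "('b \<Rightarrow> nat \<Rightarrow> bit) \<Rightarrow> 'b set \<Rightarrow> bool" where
  "zero_sum_free \<phi> I \<longleftrightarrow> (\<forall>J\<subseteq>I. sum \<phi> J = 0 \<longrightarrow> J = {})"

lemma zero_sum_free_card_le_dim:
  assumes fin: "finite X" and I: "I \<subseteq> X" "zero_sum_free \<phi> I"
  shows "card I \<le> seq_space.dim (\<phi> ` X)"
proof -
  have finI: "finite I" using fin I finite_subset by blast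
  have inj: "inj_on \<phi> I"
  proof (rule inj_onI, rule ccontr)
    \<comment> \<open>Two equal vectors would already sum to zero.\<close>
    fix x y assume "x \<in> I" "y \<in> I" "\<phi> x = \<phi> y" "x \<noteq> y"
    then have "sum \<phi> {x, y} = 0" "{x, y} \<subseteq> I" by (auto simp: bit_vector_add_eq_0)
    then show False using I(2) unfolding zero_sum_free_def by blast
  qed
  have "seq_space.independent (\<phi> ` I)"
  proof
    assume "seq_space.dependent (\<phi> ` I)"
    then obtain i where i: "i \<in> I" "\<phi> i \<in> seq_space.span (\<phi> ` I - {\<phi> i})"
      unfolding seq_space.dependent_def by blast
    have "\<phi> ` I - {\<phi> i} = \<phi> ` (I - {i})" using inj i(1) by (auto simp: inj_on_def)
    then obtain C where C: "C \<subseteq> I - {i}" "\<phi> i = sum \<phi> C"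
      using i(2) span_bit_subset_sum[of "I - {i}" "\<phi> i" \<phi>] finI by auto
    then have "sum \<phi> (insert i C) = sum \<phi> C + sum \<phi> C" "insert i C \<subseteq> I"
      using finite_subset[of C "I - {i}"] finI i(1) by (auto simp: sum.insert_if)
    then have "sum \<phi> (insert i C) = 0" "insert i C \<subseteq> I" by simp_all
    then show False using I(2) unfolding zero_sum_free_def by blast
  qed
  then have "card I = seq_space.dim (\<phi> ` I)"
    using seq_space.dim_eq_card_independent card_image[OF inj] by metis
  also have "\<dots> \<le> seq_space.dim (\<phi> ` X)"
    using dim_mono_finite fin I(1) by (meson finite_imageI image_mono)
  finally show ?thesis .
qed

lemma zero_sum_free_basis_exists:
  fixes \<phi> :: "'b \<Rightarrow> nat \<Rightarrow> bit"
  assumes "finite X"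
  obtains B where "B \<subseteq> X" "zero_sum_free \<phi> B" "card B = seq_space.dim (\<phi> ` X)"
    "\<phi> ` X \<subseteq> seq_space.span (\<phi> ` B)"
proof -
  obtain V where V: "V \<subseteq> \<phi> ` X" "seq_space.independent V" "seq_space.span V = seq_space.span (\<phi> ` X)"
    "card V = seq_space.dim (\<phi> ` X)"
    using dim_finite_basis[of "\<phi> ` X"] assms by auto
  obtain B where B: "B \<subseteq> X" "inj_on \<phi> B" "V = \<phi> ` B"
    using V(1) unfolding subset_image_inj by blast
  have finB: "finite B" using B assms finite_subset by blast
  have "zero_sum_free \<phi> B"
    unfolding zero_sum_free_def
  proof (intro allI impI, rule ccontr)
    fix J assume J: "J \<subseteq> B" "sum \<phi> J = 0" "J \<noteq> {}"
    then obtain j where j: "j \<in> J" by blast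
    have "finite J" using J finB finite_subset by blast
    then have "\<phi> j = sum \<phi> (J - {j})"
      using J(2) j by (simp add: sum.remove bit_vector_add_eq_0)
    moreover have "sum \<phi> (J - {j}) \<in> seq_space.span (V - {\<phi> j})"
    proof (rule seq_space.span_sum)
      fix x assume "x \<in> J - {j}"
      then have "\<phi> x \<in> V - {\<phi> j}" using B J(1) j by (auto simp: inj_on_def)
      then show "\<phi> x \<in> seq_space.span (V - {\<phi> j})" by (rule seq_space.span_base)
    qed
    ultimately show False
      using V(2) B(3) J(1) j unfolding seq_space.dependent_def by (metis imageI subsetD)
  qed
  moreover have "card B = seq_space.dim (\<phi> ` X)" using B V(4) by (metis card_image)
  moreover have "\<phi> ` X \<subseteq> seq_space.span (\<phi> ` B)"
    using V(3) B(3) seq_space.span_superset by metis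
  ultimately show thesis using that B(1) by blast
qed

section \<open>Clones in binary matroids\<close>

text \<open>
  The key use of characteristic 2. If \<open>\<phi> x\<close> lies in the span of \<open>B\<close> but of no proper subset of \<open>B\<close>,
  then \<open>\<phi> x\<close> can only be the sum over all of \<open>B\<close>. The hypothesis on \<open>x\<close> and \<open>y\<close> makes the same \<open>B\<close>
  minimal for \<open>y\<close>, so both vectors are this one sum. Over a larger field different coefficients
  could keep them apart.
\<close>

lemma clones_in_closure_same_vector:
  fixes \<phi> :: "'b \<Rightarrow> nat \<Rightarrow> bit"
  assumes fin: "finite A"
    and clones: "\<And>Z. Z \<subseteq> A \<Longrightarrow> \<phi> x \<in> seq_space.span (\<phi> ` Z) \<longleftrightarrow> \<phi> y \<in> seq_space.span (\<phi> ` Z)"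
    and x: "\<phi> x \<in> seq_space.span (\<phi> ` A)"
  shows "\<phi> x = \<phi> y"
proof -
  let ?F = "{B. B \<subseteq> A \<and> \<phi> x \<in> seq_space.span (\<phi> ` B)}"
  have "finite ?F" "A \<in> ?F" using fin x by auto
  then obtain B where BF: "B \<in> ?F" and min': "\<forall>C\<in>?F. C \<subseteq> B \<longrightarrow> B = C"
    using finite_has_minimal2[of ?F A] by blast
  have B: "B \<subseteq> A" "\<phi> x \<in> seq_space.span (\<phi> ` B)" using BF by auto
  have min: "C = B" if "C \<subseteq> B" "\<phi> x \<in> seq_space.span (\<phi> ` C)" for C
    using min' that B(1) by blast
  have whole: "\<phi> z = sum \<phi> B"
    if z: "z = x \<or> z = y" for z
  proof -
    have "\<phi> z \<in> seq_space.span (\<phi> ` B)" using z B clones by blast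
    then obtain C where C: "C \<subseteq> B" "\<phi> z = sum \<phi> C"
      using span_bit_subset_sum finite_subset[OF B(1) fin] by metis
    then have "\<phi> z \<in> seq_space.span (\<phi> ` C)"
      by (auto intro: seq_space.span_sum seq_space.span_base)
    then have "\<phi> x \<in> seq_space.span (\<phi> ` C)" using z clones B(1) C(1) by blast
    then show ?thesis using min C by blast
  qed
  show ?thesis using whole[of x] whole[of y] by simp
qed

section \<open>The natural matroid\<close>

lemma polymatroidD:
  assumes "polymatroid (E, \<rho>)"
  shows "finite E" "\<rho> {} = 0"
    and "A \<subseteq> B \<Longrightarrow> B \<subseteq> E \<Longrightarrow> \<rho> A \<le> \<rho> B"
    and "A \<subseteq> E \<Longrightarrow> B \<subseteq> E \<Longrightarrow> \<rho> (A \<inter> B) + \<rho> (A \<union> B) \<le> \<rho> A + \<rho> B"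
  using assms unfolding polymatroid_def by auto

lemma natural_matroid_rank_le:
  assumes "finite E" "A \<subseteq> E"
  shows "snd (natural_matroid k (E, \<rho>)) X \<le> \<rho> A + int (card (X - A \<times> {..<k}))"
  unfolding natural_matroid_def using assms by (auto intro!: Min_le)

lemma natural_matroid_rank_attained:
  assumes "finite E"
  obtains A where "A \<subseteq> E"
    "snd (natural_matroid k (E, \<rho>)) X = \<rho> A + int (card (X - A \<times> {..<k}))"
proof -
  have "snd (natural_matroid k (E, \<rho>)) X
      \<in> (\<lambda>A. \<rho> A + int (card (X - A \<times> {..<k}))) ` Pow E"
    unfolding natural_matroid_def by (auto intro!: Min_in simp: assms simp del: Pow_iff)
  then show thesis using that by auto
qed

lemma fst_natural_matroid [simp]: "fst (natural_matroid k (E, \<rho>)) = E \<times> {..<k}"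
  by (simp add: natural_matroid_def)

text \<open>
  In \<open>card (X - A \<times> {..<k})\<close> the second components of the elements of \<open>X\<close> enter only through their
  number, so elements attached to the same \<open>b\<close> are interchangeable.
\<close>

lemma natural_matroid_clones:
  assumes "i < k" "j < k" "(b, i) \<notin> Z" "(b, j) \<notin> Z" "finite Z"
  shows "snd (natural_matroid k (E, \<rho>)) (insert (b, i) Z) = snd (natural_matroid k (E, \<rho>)) (insert (b, j) Z)"
proof -
  have "card (insert (b, i) Z - A \<times> {..<k}) = card (insert (b, j) Z - A \<times> {..<k})" for A
    using assms by (auto simp: insert_Diff_if)
  then show ?thesis unfolding natural_matroid_def by simp
qed

lemma rank_le_rank_plus_missing:
  assumes P: "k_polymatroid k (E, \<rho>)" and "B \<subseteq> C" "C \<subseteq> E"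
  shows "\<rho> C \<le> \<rho> B + int k * int (card (C - B))"
proof -
  have poly: "polymatroid (E, \<rho>)" and le: "\<And>e. e \<in> E \<Longrightarrow> \<rho> {e} \<le> int k"
    using P unfolding k_polymatroid_def by auto
  have "D \<subseteq> E \<Longrightarrow> \<rho> (B \<union> D) \<le> \<rho> B + int k * int (card D)" if "finite D" for D
    using that
  proof (induction D rule: finite_induct)
    case empty
    then show ?case by simp
  next
    case (insert d D)
    have "\<rho> (B \<union> insert d D) \<le> \<rho> (B \<union> D) + \<rho> {d}"
    proof (cases "d \<in> B")
      case True
      moreover have "0 \<le> \<rho> {d}" using polymatroidD(2)[OF poly] polymatroidD(3)[OF poly, of "{}" "{d}"] insert.prems by auto
      ultimately show ?thesis by (simp add: insert_absorb)
    next
      case False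
      then have "(B \<union> D) \<inter> {d} = {}" using insert.hyps by auto
      then show ?thesis
        using polymatroidD(2)[OF poly] polymatroidD(4)[OF poly, of "B \<union> D" "{d}"] insert.prems assms(2,3) by auto
    qed
    then show ?case using insert le[of d] by (auto simp: algebra_simps)
  qed
  from this[of "C - B"] show ?thesis
    using assms(2,3) polymatroidD(1)[OF poly] by (metis Diff_subset Un_Diff_cancel finite_Diff finite_subset subset_trans sup.absorb2)
qed

text \<open>
  Fix two elements \<open>x\<close> and \<open>y\<close> attached to \<open>b\<close> and let \<open>A\<close> be the rest of the natural matroid. If the
  marginal of \<open>b\<close> were at most \<open>k - 2\<close>, the \<open>k - 2\<close> elements attached to \<open>b\<close> that remain in \<open>A\<close>
  would suffice to keep the rank of \<open>A\<close> at \<open>\<rho> E\<close>, so \<open>x\<close> would lie in the closure of \<open>A\<close>. The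
  clones \<open>x\<close> and \<open>y\<close> would then have equal vectors, whereas \<open>2 \<le> \<rho> {b}\<close> makes their rank 2.
\<close>

lemma binary_natural_matroid_large_marginal:
  assumes P: "(E, \<rho>) \<in> P_U24 k" and b: "b \<in> E" "2 \<le> \<rho> {b}"
  shows "int k - 1 \<le> \<rho> E - \<rho> (E - {b})"
proof (rule ccontr)
  assume small: "\<not> ?thesis"
  have kp: "k_polymatroid k (E, \<rho>)" and "binary (natural_matroid k (E, \<rho>))"
    using P unfolding P_U24_def by auto
  then obtain \<phi> :: "'a \<times> nat \<Rightarrow> nat \<Rightarrow> bit" where rep: "represents \<phi> (natural_matroid k (E, \<rho>))"
    unfolding binary_def by blast
  have poly: "polymatroid (E, \<rho>)" and kb: "\<rho> {b} \<le> int k"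
    using kp b unfolding k_polymatroid_def by auto
  note fin = polymatroidD(1)[OF poly]
  let ?r = "snd (natural_matroid k (E, \<rho>))"
  let ?x = "(b, 0::nat)" and ?y = "(b, 1::nat)"
  have k2: "2 \<le> k" using b kb by linarith
  define A where "A = E \<times> {..<k} - {?x, ?y}"
  have dim: "?r X = int (seq_space.dim (\<phi> ` X))" if "X \<subseteq> E \<times> {..<k}" for X
    using rep that unfolding represents_def by simp
  have sub: "insert ?x A \<subseteq> E \<times> {..<k}" "insert ?y A \<subseteq> E \<times> {..<k}" "A \<subseteq> E \<times> {..<k}"
    "{?x, ?y} \<subseteq> E \<times> {..<k}"
    using b k2 unfolding A_def by auto
  have finA: "finite A" using fin unfolding A_def by auto
  have "\<rho> E \<le> ?r A"
  proof -
    obtain B where B: "B \<subseteq> E" "?r A = \<rho> B + int (card (A - B \<times> {..<k}))"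
      using natural_matroid_rank_attained[OF fin] by metis
    show ?thesis
    proof (cases "b \<in> B")
      case True
      then have "A - B \<times> {..<k} = (E - B) \<times> {..<k}" using k2 unfolding A_def by auto
      then show ?thesis
        using B rank_le_rank_plus_missing[OF kp B(1)] by (simp add: card_cartesian_product mult.commute)
    next
      case False
      have "(E - {b} - B) \<times> {..<k} \<union> {b} \<times> {2..<k} \<subseteq> A - B \<times> {..<k}"
        using False b unfolding A_def by auto
      then have "card ((E - {b} - B) \<times> {..<k} \<union> {b} \<times> {2..<k}) \<le> card (A - B \<times> {..<k})"
        using finA by (intro card_mono) auto
      moreover have "card ((E - {b} - B) \<times> {..<k} \<union> {b} \<times> {2..<k}) = k * card (E - {b} - B) + (k - 2)"
        using fin by (subst card_Un_disjoint) (auto simp: card_cartesian_product mult.commute)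
      moreover have "\<rho> (E - {b}) \<le> \<rho> B + int k * int (card (E - {b} - B))"
        using rank_le_rank_plus_missing[OF kp, of B "E - {b}"] B(1) False by auto
      ultimately have "\<rho> (E - {b}) + int (k - 2) \<le> ?r A"
        using B(2) by (smt (verit) of_nat_add of_nat_mono of_nat_mult)
      then show ?thesis using small k2 by linarith
    qed
  qed
  moreover have "?r (insert ?x A) \<le> \<rho> E"
    using natural_matroid_rank_le[OF fin, of E k \<rho> "insert ?x A"] sub(1) by (simp add: Diff_eq_empty_iff[THEN iffD2])
  ultimately have "seq_space.dim (\<phi> ` insert ?x A) \<le> seq_space.dim (\<phi> ` A)"
    using dim[OF sub(1)] dim[OF sub(3)] by linarith
  then have "seq_space.dim (\<phi> ` insert ?x A) = seq_space.dim (\<phi> ` A)"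
    using dim_mono_finite[of "\<phi> ` insert ?x A" "\<phi> ` A"] finA
    by (intro antisym) (simp_all add: subset_insertI)
  then have xA: "\<phi> ?x \<in> seq_space.span (\<phi> ` A)"
    using dim_insert_eq_iff[of "\<phi> ` A"] finA by simp
  have same: "\<phi> ?x = \<phi> ?y"
  proof (rule clones_in_closure_same_vector[OF finA _ xA])
    fix Z assume Z: "Z \<subseteq> A"
    have finZ: "finite Z" using Z finA finite_subset by blast
    have "?r (insert ?x Z) = ?r (insert ?y Z)"
      using Z k2 finZ unfolding A_def by (intro natural_matroid_clones) auto
    moreover have "insert ?x Z \<subseteq> E \<times> {..<k}" "insert ?y Z \<subseteq> E \<times> {..<k}" using Z sub by auto
    ultimately have "seq_space.dim (insert (\<phi> ?x) (\<phi> ` Z)) = seq_space.dim (insert (\<phi> ?y) (\<phi> ` Z))"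
      by (simp add: dim)
    then show "\<phi> ?x \<in> seq_space.span (\<phi> ` Z) \<longleftrightarrow> \<phi> ?y \<in> seq_space.span (\<phi> ` Z)"
      using finZ by (simp flip: dim_insert_eq_iff)
  qed
  have "2 \<le> ?r {?x, ?y}"
  proof -
    obtain B where B: "B \<subseteq> E" "?r {?x, ?y} = \<rho> B + int (card ({?x, ?y} - B \<times> {..<k}))"
      using natural_matroid_rank_attained[OF fin] by metis
    show ?thesis
    proof (cases "b \<in> B")
      case True
      then have "\<rho> {b} \<le> \<rho> B" using polymatroidD(3)[OF poly] B(1) by auto
      then show ?thesis using b B(2) by linarith
    next
      case False
      then have "{?x, ?y} - B \<times> {..<k} = {?x, ?y}" by auto
      moreover have "0 \<le> \<rho> B" using polymatroidD(2)[OF poly] polymatroidD(3)[OF poly, of "{}" B] B(1) by auto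
      ultimately show ?thesis using B(2) by simp
    qed
  qed
  moreover have "seq_space.dim (\<phi> ` {?x, ?y}) \<le> 1"
    using same seq_space.dim_le_card[of "\<phi> ` {?x, ?y}" "{\<phi> ?y}"] by (simp add: seq_space.span_base)
  ultimately show False using dim[OF sub(4)] by linarith
qed

section \<open>Replacing elements by parallel or series classes\<close>

text \<open>
  The even coordinates hold a copy of the original vectors; the odd ones provide fresh unit vectors
  that are independent of this copy.
\<close>

definition lift_vector :: "(nat \<Rightarrow> bit) \<Rightarrow> nat \<Rightarrow> bit" where
  "lift_vector v = (\<lambda>n. if even n then v (n div 2) else 0)"

definition unit_vector :: "nat \<Rightarrow> nat \<Rightarrow> bit" where
  "unit_vector m = (\<lambda>n. of_bool (n = 2 * m + 1))"

lemma lift_vector_sum: "lift_vector (sum f A) = (\<Sum>a\<in>A. lift_vector (f a))"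
  by (rule ext) (simp add: lift_vector_def sum_fun_apply)

text \<open>
  The vectors of the matroid obtained from the one represented by \<open>\<psi>\<close> by replacing each \<open>e\<close> outside
  \<open>S\<close> by \<open>k\<close> parallel copies and each \<open>e\<close> in \<open>S\<close> by \<open>k\<close> elements in series. The series class consists
  of \<open>k - 1\<close> fresh unit vectors and one vector that makes the sum of the whole class equal to
  \<open>\<psi> e\<close>. The function \<open>g\<close> numbers the fresh unit vectors.
\<close>

definition expansion :: "nat \<Rightarrow> 'a set \<Rightarrow> ('a \<times> nat \<Rightarrow> nat) \<Rightarrow> ('a \<Rightarrow> nat \<Rightarrow> bit) \<Rightarrow> 'a \<times> nat \<Rightarrow> nat \<Rightarrow> bit" where
  "expansion k S g \<psi> = (\<lambda>(e, i).
     if e \<notin> S then lift_vector (\<psi> e)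
     else if i < k - 1 then unit_vector (g (e, i))
     else lift_vector (\<psi> e) + (\<Sum>m<k - 1. unit_vector (g (e, m))))"

lemma expansion_even_coordinate:
  "expansion k S g \<psi> (f, i) (2 * n) = (if f \<in> S \<and> i < k - 1 then 0 else \<psi> f n)"
proof -
  have "2 * n \<noteq> Suc (2 * m)" for m by presburger
  then show ?thesis by (simp add: expansion_def lift_vector_def unit_vector_def sum_fun_apply)
qed

text \<open>
  The coordinate of the fresh unit vector \<open>(e, m)\<close> is seen only by that vector and by the last
  vector of the series class of \<open>e\<close>. A zero sum must therefore contain either both or neither.
\<close>

lemma expansion_odd_coordinate:
  assumes g: "inj_on g (E \<times> {..<k})" and "S \<subseteq> E" and e: "e \<in> S" "m < k - 1"
    and x: "x \<in> E \<times> {..<k}"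
  shows "expansion k S g \<psi> x (2 * g (e, m) + 1) = of_bool (x = (e, m) \<or> x = (e, k - 1))"
proof -
  obtain f i where fi: "x = (f, i)" "f \<in> E" "i < k" using x by auto
  have g_eq: "g (e, m) = g (f, j) \<longleftrightarrow> f = e \<and> j = m" if "j < k" for j
    using inj_onD[OF g, of "(e, m)" "(f, j)"] e fi that \<open>S \<subseteq> E\<close> by auto
  show ?thesis
  proof (cases "f \<in> S \<and> \<not> i < k - 1")
    case True
    then have i: "i = k - 1" using fi by auto
    have "(\<Sum>j<k - 1. unit_vector (g (f, j))) (2 * g (e, m) + 1) = (\<Sum>j<k - 1. of_bool (f = e \<and> j = m))"
      unfolding sum_fun_apply unit_vector_def using g_eq by (intro sum.cong) auto
    also have "\<dots> = of_bool (f = e)"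
      using e by (cases "f = e") (simp_all add: of_bool_def)
    finally show ?thesis
      using True fi i e by (auto simp: expansion_def lift_vector_def)
  next
    case False
    then show ?thesis
      using fi e g_eq[of i] by (auto simp: expansion_def lift_vector_def unit_vector_def)
  qed
qed

text \<open>
  A spanning set of the required size: a basis of \<open>\<psi> ` A\<close>, the fresh unit vectors of the elements of
  \<open>A \<inter> S\<close>, and the vectors of \<open>X\<close> attached to elements outside \<open>A\<close>.
\<close>

lemma expansion_dim_le:
  assumes fin: "finite E" and S: "S \<subseteq> E" and A: "A \<subseteq> E" and X: "X \<subseteq> E \<times> {..<k}"
  shows "seq_space.dim (expansion k S g \<psi> ` X)
    \<le> seq_space.dim (\<psi> ` A) + (k - 1) * card (A \<inter> S) + card (X - A \<times> {..<k})"
proof -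
  let ?\<phi> = "expansion k S g \<psi>"
  have finA: "finite A" and finX: "finite X"
    using fin A X finite_subset[of X "E \<times> {..<k}"] finite_subset by auto
  obtain B where B: "B \<subseteq> A" "card B = seq_space.dim (\<psi> ` A)" "\<psi> ` A \<subseteq> seq_space.span (\<psi> ` B)"
    using zero_sum_free_basis_exists[OF finA] by metis
  have finB: "finite B" using B finA finite_subset by auto
  define L where "L = (lift_vector \<circ> \<psi>) ` B"
  define U where "U = ?\<phi> ` ((A \<inter> S) \<times> {..<k - 1})"
  define R where "R = ?\<phi> ` (X - A \<times> {..<k})"
  have lift: "lift_vector (\<psi> e) \<in> seq_space.span (L \<union> U \<union> R)" if "e \<in> A" for e
  proof -
    obtain C where C: "C \<subseteq> B" "\<psi> e = sum \<psi> C"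
      using span_bit_subset_sum[OF finB, of "\<psi> e" \<psi>] B(3) \<open>e \<in> A\<close> by auto
    show ?thesis unfolding C(2) lift_vector_sum
      using C(1) by (intro seq_space.span_sum seq_space.span_base) (auto simp: L_def)
  qed
  have unit: "unit_vector (g (e, i)) \<in> seq_space.span (L \<union> U \<union> R)" if "e \<in> A" "e \<in> S" "i < k - 1" for e i
  proof -
    have "unit_vector (g (e, i)) = ?\<phi> (e, i)" using that by (simp add: expansion_def)
    then have "unit_vector (g (e, i)) \<in> U" unfolding U_def using that by auto
    then show ?thesis by (intro seq_space.span_base) auto
  qed
  have "?\<phi> x \<in> seq_space.span (L \<union> U \<union> R)" if "x \<in> X" for x
  proof (cases "x \<in> A \<times> {..<k}")
    case True
    then show ?thesis
      using lift unit by (auto simp: expansion_def intro!: seq_space.span_add seq_space.span_sum)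
  next
    case False
    then show ?thesis using that by (intro seq_space.span_base) (auto simp: R_def)
  qed
  then have "seq_space.dim (?\<phi> ` X) \<le> card (L \<union> U \<union> R)"
    using finA finB finX
    by (intro seq_space.dim_le_card) (auto simp: L_def U_def R_def)
  also have "\<dots> \<le> card L + card U + card R"
    by (meson add_mono card_Un_le le_refl order_trans)
  also have "card L \<le> seq_space.dim (\<psi> ` A)"
    unfolding L_def B(2)[symmetric] using finB by (rule card_image_le)
  also have "card U \<le> (k - 1) * card (A \<inter> S)"
    using card_image_le[of "(A \<inter> S) \<times> {..<k - 1}" ?\<phi>] finA
    by (simp add: U_def card_cartesian_product mult.commute)
  also have "card R \<le> card (X - A \<times> {..<k})"
    unfolding R_def using finX by (intro card_image_le) auto
  finally show ?thesis by simp
qed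

text \<open>
  The bound of \<open>expansion_dim_le\<close> is attained when \<open>A\<close> consists of the elements whose original vector
  is recovered by \<open>X\<close>: a series class contributes \<open>\<psi> e\<close> only if \<open>X\<close> contains all of it, a parallel
  class as soon as \<open>X\<close> meets it. The proof exhibits an independent subset of \<open>X\<close> of the right size.
\<close>

lemma expansion_dim_ge:
  assumes fin: "finite E" and S: "S \<subseteq> E" and X: "X \<subseteq> E \<times> {..<k}" and k: "1 \<le> k"
    and g: "inj_on g (E \<times> {..<k})"
  shows "\<exists>A\<subseteq>E. seq_space.dim (\<psi> ` A) + (k - 1) * card (A \<inter> S) + card (X - A \<times> {..<k})
    \<le> seq_space.dim (expansion k S g \<psi> ` X)"
proof -
  let ?\<phi> = "expansion k S g \<psi>"
  define F where "F = {e \<in> S. {e} \<times> {..<k} \<subseteq> X}"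
  define P where "P = {e \<in> E - S. \<exists>i. (e, i) \<in> X}"
  define A where "A = F \<union> P"
  have AE: "A \<subseteq> E" and AS: "A \<inter> S = F" unfolding A_def F_def P_def using S by auto
  have finA: "finite A" and finF: "finite F" and finX: "finite X"
    using fin AE X finite_subset[of X "E \<times> {..<k}"] finite_subset A_def by auto
  obtain B where B: "B \<subseteq> A" "zero_sum_free \<psi> B" "card B = seq_space.dim (\<psi> ` A)"
    using zero_sum_free_basis_exists[OF finA] by metis
  have finB: "finite B" using B finA finite_subset by auto
  \<comment> \<open>In the attached class, \<open>h e\<close> picks the element of \<open>X\<close> that carries the vector \<open>\<psi> e\<close>.\<close>
  define h where "h e = (if e \<in> S then k - 1 else (SOME i. (e, i) \<in> X))" for e
  have hX: "(e, h e) \<in> X" if "e \<in> B" for e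
  proof (cases "e \<in> S")
    case True
    then have "e \<in> F" using that B AS by auto
    then show ?thesis using True k by (auto simp: F_def h_def)
  next
    case False
    then have "\<exists>i. (e, i) \<in> X" using that B(1) unfolding A_def F_def P_def by auto
    then show ?thesis using False using someI_ex[of "\<lambda>i. (e, i) \<in> X"] by (simp add: h_def)
  qed
  define I1 where "I1 = X - A \<times> {..<k}"
  define I2 where "I2 = F \<times> {..<k - 1}"
  define I3 where "I3 = (\<lambda>e. (e, h e)) ` B"
  let ?I = "I1 \<union> I2 \<union> I3"
  have IX: "?I \<subseteq> X" using hX unfolding I1_def I2_def I3_def F_def by auto
  have I1S: "e \<in> S" if "(e, i) \<in> I1" for e i
    using that X unfolding I1_def A_def P_def by auto
  have zsf: "zero_sum_free ?\<phi> ?I"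
    unfolding zero_sum_free_def
  proof (intro allI impI)
    fix J assume J: "J \<subseteq> ?I" "sum ?\<phi> J = 0"
    have JX: "J \<subseteq> X" using J IX by blast
    then have finJ: "finite J" using finX finite_subset by blast
    have all_or_none: "(e, m) \<in> J \<longleftrightarrow> (e, k - 1) \<in> J" if e: "e \<in> S" "m < k - 1" for e m
    proof -
      have "0 = (\<Sum>x\<in>J. ?\<phi> x (2 * g (e, m) + 1))"
        using J(2) sum_fun_apply[of ?\<phi> J "2 * g (e, m) + 1"] by simp
      also have "\<dots> = (\<Sum>x\<in>J. of_bool (x = (e, m)) + of_bool (x = (e, k - 1)))"
      proof (rule sum.cong[OF refl])
        fix x assume "x \<in> J"
        then have "x \<in> E \<times> {..<k}" using JX X by blast
        then show "?\<phi> x (2 * g (e, m) + 1) = of_bool (x = (e, m)) + of_bool (x = (e, k - 1))"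
          using expansion_odd_coordinate[OF g S e] e by auto
      qed
      also have "\<dots> = of_bool ((e, m) \<in> J) + of_bool ((e, k - 1) \<in> J)"
        using finJ by (simp add: sum.distrib of_bool_def del: add_bit_eq_xor)
      finally show ?thesis by (auto split: if_splits simp: of_bool_def)
    qed
    \<comment> \<open>An element of \<open>J\<close> that involves an original vector cannot belong to an incomplete series
      class, since \<open>J\<close> contains all or nothing of each series class.\<close>
    have top_in_B: "e \<in> B \<and> h e = i" if x: "(e, i) \<in> J" "\<not> (e \<in> S \<and> i < k - 1)" for e i
    proof -
      have "(e, i) \<notin> I1"
      proof
        assume "(e, i) \<in> I1"
        then have "e \<in> S" "i < k" "e \<notin> A" using I1S X unfolding I1_def by auto
        then have i: "i = k - 1" using x by auto
        have "(e, m) \<in> J" if "m < k" for m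
          using that all_or_none[of e m] \<open>e \<in> S\<close> x(1) i by (cases "m = k - 1") auto
        then have "e \<in> F" using JX \<open>e \<in> S\<close> unfolding F_def by auto
        then show False using \<open>e \<notin> A\<close> unfolding A_def by blast
      qed
      moreover have "(e, i) \<notin> I2" using x(2) S unfolding I2_def F_def by auto
      ultimately show ?thesis using J(1) x(1) unfolding I3_def by auto
    qed
    define T where "T = {x \<in> J. \<not> (fst x \<in> S \<and> snd x < k - 1)}"
    have T_graph: "T = (\<lambda>e. (e, h e)) ` (fst ` T)" and TB: "fst ` T \<subseteq> B"
      using top_in_B unfolding T_def by force+
    \<comment> \<open>The even coordinates turn the zero sum over \<open>J\<close> into one of original vectors.\<close>
    have "sum \<psi> (fst ` T) = 0"
    proof
      fix n
      have "0 = (\<Sum>x\<in>J. ?\<phi> x (2 * n))"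
        using J(2) sum_fun_apply[of ?\<phi> J "2 * n"] by simp
      also have "\<dots> = (\<Sum>x\<in>T. \<psi> (fst x) n)"
        unfolding T_def sum.inter_filter[OF finJ]
        by (intro sum.cong) (auto simp: expansion_even_coordinate)
      also have "\<dots> = (\<Sum>e\<in>fst ` T. \<psi> e n)"
        by (subst T_graph, subst sum.reindex) (auto simp: inj_on_def)
      finally show "sum \<psi> (fst ` T) n = 0 n" by (simp add: sum_fun_apply)
    qed
    then have "T = {}" using B(2) TB unfolding zero_sum_free_def by blast
    then have low: "e \<in> S \<and> i < k - 1" if "(e, i) \<in> J" for e i
      using that unfolding T_def by force
    have "(e, i) \<notin> J" for e i
      using low[of e i] low[of e "k - 1"] all_or_none[of e i] by auto
    then show "J = {}" by auto
  qed
  have "card ?I = card I1 + card I2 + card I3"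
  proof -
    have "finite I1" "finite I2" "finite I3"
      using finX finF finB unfolding I1_def I2_def I3_def by auto
    moreover have "I1 \<inter> I2 = {}" unfolding I1_def I2_def A_def by auto
    moreover have "(I1 \<union> I2) \<inter> I3 = {}"
      using B(1) hX X unfolding I1_def I2_def I3_def h_def F_def by auto
    ultimately show ?thesis by (simp add: card_Un_disjoint)
  qed
  moreover have "card I2 = (k - 1) * card (A \<inter> S)"
    by (simp add: I2_def AS card_cartesian_product mult.commute)
  moreover have "card I3 = seq_space.dim (\<psi> ` A)"
    unfolding I3_def B(3)[symmetric] by (intro card_image) (auto simp: inj_on_def)
  ultimately have "card ?I = seq_space.dim (\<psi> ` A) + (k - 1) * card (A \<inter> S) + card (X - A \<times> {..<k})"
    by (simp add: I1_def)
  then show ?thesis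
    using zero_sum_free_card_le_dim[OF finX IX zsf] AE by (intro exI[of _ A]) simp
qed

lemma binary_natural_matroid_of_binary:
  assumes fin: "finite E" and k: "1 \<le> k" and S: "S \<subseteq> E" and bin: "binary (E, \<sigma>)"
    and \<rho>: "\<And>A. A \<subseteq> E \<Longrightarrow> \<rho> A = \<sigma> A + (int k - 1) * int (card (A \<inter> S))"
  shows "binary (natural_matroid k (E, \<rho>))"
proof -
  obtain \<psi> :: "'a \<Rightarrow> nat \<Rightarrow> bit" where "represents \<psi> (E, \<sigma>)"
    using bin unfolding binary_def by blast
  then have \<psi>: "\<sigma> A = int (seq_space.dim (\<psi> ` A))" if "A \<subseteq> E" for A
    using that unfolding represents_def by simp
  obtain g :: "'a \<times> nat \<Rightarrow> nat" where g: "inj_on g (E \<times> {..<k})"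
    using finite_imp_inj_to_nat_seg[of "E \<times> {..<k}"] fin by auto
  have \<rho>_dim: "\<rho> A + int c = int (seq_space.dim (\<psi> ` A) + (k - 1) * card (A \<inter> S) + c)"
    if "A \<subseteq> E" for A c
    using \<rho>[OF that] \<psi>[OF that] k by (simp add: of_nat_diff)
  have "represents (expansion k S g \<psi>) (natural_matroid k (E, \<rho>))"
    unfolding represents_def fst_natural_matroid
  proof (intro allI impI antisym)
    fix X assume X: "X \<subseteq> E \<times> {..<k}"
    obtain A where A: "A \<subseteq> E" "seq_space.dim (\<psi> ` A) + (k - 1) * card (A \<inter> S) + card (X - A \<times> {..<k})
        \<le> seq_space.dim (expansion k S g \<psi> ` X)"
      using expansion_dim_ge[OF fin S X k g] by blast
    then show "snd (natural_matroid k (E, \<rho>)) X \<le> int (seq_space.dim (expansion k S g \<psi> ` X))"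
      using natural_matroid_rank_le[OF fin A(1), of k \<rho> X] \<rho>_dim[OF A(1), of "card (X - A \<times> {..<k})"]
      by linarith
    obtain A' where A': "A' \<subseteq> E"
      "snd (natural_matroid k (E, \<rho>)) X = \<rho> A' + int (card (X - A' \<times> {..<k}))"
      using natural_matroid_rank_attained[OF fin] by metis
    show "int (seq_space.dim (expansion k S g \<psi> ` X)) \<le> snd (natural_matroid k (E, \<rho>)) X"
      unfolding A'(2) \<rho>_dim[OF A'(1)] using expansion_dim_le[OF fin S A'(1) X] by (rule of_nat_mono)
  qed
  then show ?thesis unfolding binary_def by blast
qed

section \<open>Matroids on at most three elements\<close>

lemma k_polymatroid_restrict:
  "k_polymatroid k (E, \<rho>) \<Longrightarrow> F \<subseteq> E \<Longrightarrow> k_polymatroid k (F, \<rho>)"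
  unfolding k_polymatroid_def polymatroid_def using finite_subset[of F E]
  by (simp add: subset_iff)

text \<open>
  Monotonicity of the closure operator: \<open>\<sigma> (insert c A) = \<sigma> A\<close> expresses that \<open>c\<close> lies in the
  closure of \<open>A\<close>.
\<close>

lemma matroid_closure_mono:
  assumes "polymatroid (E, \<sigma>)" and "A \<subseteq> B" "insert c B \<subseteq> E" and "\<sigma> (insert c A) = \<sigma> A"
  shows "\<sigma> (insert c B) = \<sigma> B"
proof (cases "c \<in> B")
  case True
  then show ?thesis by (simp add: insert_absorb)
next
  case False
  then have "insert c A \<inter> B = A" "insert c A \<union> B = insert c B" using assms(2) by auto
  then have "\<sigma> (insert c B) \<le> \<sigma> B"
    using polymatroidD(4)[OF assms(1), of "insert c A" B] assms by auto
  then show ?thesis using polymatroidD(3)[OF assms(1), of B "insert c B"] assms by (simp add: subset_insertI)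
qed

text \<open>
  A matroid is a polymatroid whose singletons have rank at most 1, that is, a 1-polymatroid.
  Adding \<open>c\<close> to a set raises its rank by 0 or 1, and so does adding a vector to a span; hence it
  is enough that the two agree on when the rank stays the same.
\<close>

lemma represents_extend:
  fixes \<psi> :: "'a \<Rightarrow> nat \<Rightarrow> bit"
  assumes M: "k_polymatroid 1 (insert c E, \<sigma>)" and c: "c \<notin> E" and rep: "represents \<psi> (E, \<sigma>)"
    and v: "\<And>A. A \<subseteq> E \<Longrightarrow> v \<in> seq_space.span (\<psi> ` A) \<longleftrightarrow> \<sigma> (insert c A) = \<sigma> A"
  shows "represents (\<psi>(c := v)) (insert c E, \<sigma>)"
  unfolding represents_def fst_conv snd_conv
proof (intro allI impI)
  have poly: "polymatroid (insert c E, \<sigma>)" using M unfolding k_polymatroid_def by blast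
  have fin: "finite E" using polymatroidD(1)[OF poly] by simp
  have dim: "\<sigma> A = int (seq_space.dim (\<psi> ` A))" if "A \<subseteq> E" for A
    using rep that unfolding represents_def by simp
  fix X assume X: "X \<subseteq> insert c E"
  define A where "A = X - {c}"
  have A: "A \<subseteq> E" "c \<notin> A" and finA: "finite A" using X fin finite_subset unfolding A_def by auto
  have im: "\<psi>(c := v) ` A = \<psi> ` A" using A by auto
  show "\<sigma> X = int (seq_space.dim (\<psi>(c := v) ` X))"
  proof (cases "c \<in> X")
    case False
    then show ?thesis using im dim A by (simp add: A_def)
  next
    case True
    then have X_eq: "X = insert c A" by (auto simp: A_def)
    have image: "\<psi>(c := v) ` X = insert v (\<psi> ` A)" unfolding X_eq image_insert im by simp
    have "insert c A - A = {c}" using A by auto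
    then have "\<sigma> X \<le> \<sigma> A + 1"
      using rank_le_rank_plus_missing[OF M, of A X] A X X_eq by auto
    moreover have "\<sigma> A \<le> \<sigma> X" using polymatroidD(3)[OF poly, of A X] X X_eq by auto
    ultimately have "\<sigma> X = (if v \<in> seq_space.span (\<psi> ` A) then \<sigma> A else \<sigma> A + 1)"
      using v[OF A(1)] X_eq by auto
    then show ?thesis
      unfolding image using dim[OF A(1)] finA by (simp add: dim_insert_in_span dim_insert_notin_span)
  qed
qed

text \<open>
  The span consists of the finitely many subset sums, whereas the space of sequences is infinite.
\<close>

lemma vector_outside_span_exists:
  fixes \<psi> :: "'a \<Rightarrow> nat \<Rightarrow> bit"
  assumes "finite A"
  shows "\<exists>v. v \<notin> seq_space.span (\<psi> ` A)"
proof -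
  have "seq_space.span (\<psi> ` A) \<subseteq> sum \<psi> ` Pow A"
    using span_bit_subset_sum[OF assms] by blast
  then have "finite (seq_space.span (\<psi> ` A))"
    using assms by (meson finite_Pow_iff finite_imageI finite_subset)
  moreover have "inj unit_vector"
  proof (rule injI)
    fix x y assume "unit_vector x = unit_vector y"
    then have "unit_vector y (2 * x + 1) = 1" by (metis of_bool_eq(2) unit_vector_def)
    then show "x = y" by (simp add: unit_vector_def split: if_splits)
  qed
  then have "infinite (range unit_vector)" by (simp add: finite_image_iff)
  ultimately show ?thesis by (meson UNIV_I finite_subset subsetI)
qed

text \<open>
  Let \<open>C\<close> be a minimal subset of \<open>E\<close> with \<open>c\<close> in its closure, if there is one. If there is none, \<open>c\<close> is
  a coloop and any vector outside the span of \<open>E\<close> serves. If \<open>C\<close> is empty, \<open>c\<close> is a loop; if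
  \<open>C = {a}\<close>, it is parallel to \<open>a\<close>; and if \<open>C = E\<close>, then \<open>c\<close> lies in the closure of \<open>E\<close> but of
  no proper subset, so it takes the sum of all vectors of \<open>E\<close>. The bound on \<open>card E\<close> leaves no other
  possibility.
\<close>

lemma extension_vector_exists:
  fixes \<psi> :: "'a \<Rightarrow> nat \<Rightarrow> bit"
  assumes M: "k_polymatroid 1 (insert c E, \<sigma>)" and card: "card E \<le> 2"
    and rep: "represents \<psi> (E, \<sigma>)"
  shows "\<exists>v. \<forall>A\<subseteq>E. v \<in> seq_space.span (\<psi> ` A) \<longleftrightarrow> \<sigma> (insert c A) = \<sigma> A"
proof -
  have poly: "polymatroid (insert c E, \<sigma>)" and le1: "\<And>e. e \<in> insert c E \<Longrightarrow> \<sigma> {e} \<le> 1"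
    using M unfolding k_polymatroid_def by auto
  have fin: "finite E" using polymatroidD(1)[OF poly] by simp
  have dim: "\<sigma> A = int (seq_space.dim (\<psi> ` A))" if "A \<subseteq> E" for A
    using rep that unfolding represents_def by simp
  have span: "\<psi> e \<in> seq_space.span (\<psi> ` A) \<longleftrightarrow> \<sigma> (insert e A) = \<sigma> A" if "e \<in> E" "A \<subseteq> E" for e A
    using that dim[of A] dim[of "insert e A"] dim_insert_eq_iff[of "\<psi> ` A" "\<psi> e"]
      finite_subset[OF that(2) fin] by auto
  let ?cl = "\<lambda>A. \<sigma> (insert c A) = \<sigma> A"
  have cl_mono: "?cl B" if "?cl A" "A \<subseteq> B" "B \<subseteq> E" for A B
    using matroid_closure_mono[OF poly, of A B c] that by auto
  show ?thesis
  proof (cases "?cl E")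
    case False
    obtain v where "v \<notin> seq_space.span (\<psi> ` E)" using vector_outside_span_exists[OF fin] by blast
    then have "v \<notin> seq_space.span (\<psi> ` A) \<and> \<not> ?cl A" if "A \<subseteq> E" for A
      using that False cl_mono[of A E] seq_space.span_mono[of "\<psi> ` A" "\<psi> ` E"] by auto
    then show ?thesis by blast
  next
    case clE: True
    have "finite {A. A \<subseteq> E \<and> ?cl A}" "E \<in> {A. A \<subseteq> E \<and> ?cl A}" using fin clE by auto
    then obtain C where C: "C \<in> {A. A \<subseteq> E \<and> ?cl A}" and min: "\<forall>A\<in>{A. A \<subseteq> E \<and> ?cl A}. A \<subseteq> C \<longrightarrow> C = A"
      using finite_has_minimal2[of "{A. A \<subseteq> E \<and> ?cl A}" E] by blast
    have "card C \<le> card E" using C fin by (auto intro: card_mono)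
    then consider "C = {}" | a where "C = {a}" | "C = E"
      using C fin card finite_subset[of C E] card_subset_eq[of E C]
      by (cases "card C" rule: linorder_cases[of _ 1]) (auto simp: card_1_singleton_iff)
    then show ?thesis
    proof cases
      case 1
      then have "0 \<in> seq_space.span (\<psi> ` A) \<and> ?cl A" if "A \<subseteq> E" for A
        using that C cl_mono[of "{}" A] seq_space.span_zero by auto
      then show ?thesis by blast
    next
      case (2 a)
      then have a: "a \<in> E" "?cl {a}" and "\<not> ?cl {}" using C min by auto
      then have "\<sigma> {c} \<noteq> 0" using polymatroidD(2)[OF poly] by simp
      moreover have "\<sigma> {} \<le> \<sigma> {c}" "\<sigma> {c} \<le> \<sigma> {c, a}"
        by (rule polymatroidD(3)[OF poly]; use a in auto)+
      ultimately have "\<sigma> (insert a {c}) = \<sigma> {c}"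
        using a le1[of a] le1[of c] polymatroidD(2)[OF poly] by (auto simp: insert_commute)
      then have "\<sigma> (insert a (insert c A)) = \<sigma> (insert c A)" if "A \<subseteq> E" for A
        using matroid_closure_mono[OF poly, of "{c}" "insert c A" a] a that by auto
      moreover have "\<sigma> (insert c (insert a A)) = \<sigma> (insert a A)" if "A \<subseteq> E" for A
        using cl_mono[OF a(2), of "insert a A"] a that by auto
      ultimately have "\<sigma> (insert a A) = \<sigma> (insert c A)" if "A \<subseteq> E" for A
        using that by (simp add: insert_commute)
      then have "\<psi> a \<in> seq_space.span (\<psi> ` A) \<longleftrightarrow> ?cl A" if "A \<subseteq> E" for A
        using span[OF a(1) that] that by simp
      then show ?thesis by blast
    next
      case 3
      have "sum \<psi> E \<in> seq_space.span (\<psi> ` A) \<longleftrightarrow> ?cl A" if A: "A \<subseteq> E" for A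
      proof (cases "A = E")
        case True
        then show ?thesis using clE by (auto intro: seq_space.span_sum seq_space.span_base)
      next
        case False
        then have "\<not> ?cl A" using A 3 min by auto
        moreover have "sum \<psi> E \<notin> seq_space.span (\<psi> ` A)"
        proof
          assume sum: "sum \<psi> E \<in> seq_space.span (\<psi> ` A)"
          obtain e where e: "e \<in> E" "e \<notin> A" using A False by blast
          let ?D = "E - {e}"
          have "sum \<psi> E \<in> seq_space.span (\<psi> ` ?D)"
            using sum seq_space.span_mono[of "\<psi> ` A" "\<psi> ` ?D"] A e by blast
          moreover have "sum \<psi> ?D \<in> seq_space.span (\<psi> ` ?D)"
            by (intro seq_space.span_sum seq_space.span_base) auto
          moreover have "sum \<psi> E = \<psi> e + sum \<psi> ?D"
            using fin e by (simp add: sum.remove)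
          ultimately have "\<psi> e \<in> seq_space.span (\<psi> ` ?D)"
            using seq_space.span_add_eq2 by metis
          then have "\<sigma> E = \<sigma> ?D" using span[of e ?D] e by (simp add: insert_absorb)
          moreover have "\<sigma> ?D \<le> \<sigma> (insert c ?D)" "\<sigma> (insert c ?D) \<le> \<sigma> (insert c E)"
            by (rule polymatroidD(3)[OF poly]; auto)+
          ultimately have "?cl ?D" using clE by linarith
          then have "C = ?D" using 3 min by auto
          then show False using 3 e by blast
        qed
        ultimately show ?thesis by blast
      qed
      then show ?thesis by blast
    qed
  qed
qed

lemma matroid_card_le_3_binary:
  assumes "k_polymatroid 1 (E, \<sigma>)" and "card E \<le> 3"
  shows "binary (E, \<sigma>)"
proof -
  have "finite E" using assms(1) unfolding k_polymatroid_def polymatroid_def by simp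
  then show ?thesis using assms
  proof (induction E rule: finite_induct)
    case empty
    then have "represents (\<lambda>_ _. 0 :: bit) ({}, \<sigma>)"
      using seq_space.dim_eq_card_independent[OF seq_space.independent_empty]
      by (simp add: represents_def k_polymatroid_def polymatroid_def)
    then show ?case unfolding binary_def by blast
  next
    case (insert c E)
    have "k_polymatroid 1 (E, \<sigma>)" using k_polymatroid_restrict[OF insert.prems(1)] by blast
    then obtain \<psi> :: "'a \<Rightarrow> nat \<Rightarrow> bit" where \<psi>: "represents \<psi> (E, \<sigma>)"
      using insert unfolding binary_def by auto
    have "card E \<le> 2" using insert by simp
    from extension_vector_exists[OF insert.prems(1) this \<psi>] obtain v
      where "\<And>A. A \<subseteq> E \<Longrightarrow> v \<in> seq_space.span (\<psi> ` A) \<longleftrightarrow> \<sigma> (insert c A) = \<sigma> A" by blast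
    then have "represents (\<psi>(c := v)) (insert c E, \<sigma>)"
      by (rule represents_extend[OF insert.prems(1) insert.hyps(2) \<psi>])
    then show ?case unfolding binary_def by blast
  qed
qed

section \<open>Excluded minors\<close>

lemma excluded_minor_proper_minor:
  assumes "excluded_minor k (E, \<rho>)" and "X \<subseteq> E" "Y \<subseteq> E" "X \<inter> Y = {}" "X \<union> Y \<noteq> {}"
  shows "(E - X - Y, \<lambda>Z. \<rho> (Y \<union> Z) - \<rho> Y) \<in> P_U24 k"
proof -
  have "contraction (deletion (E, \<rho>) X) Y = (E - X - Y, \<lambda>Z. \<rho> (Y \<union> Z) - \<rho> Y)"
    by (simp add: contraction_def deletion_def)
  then have "proper_minor (E - X - Y, \<lambda>Z. \<rho> (Y \<union> Z) - \<rho> Y) (E, \<rho>)"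
    using assms unfolding proper_minor_def by (metis fst_conv)
  then show ?thesis using assms(1) unfolding excluded_minor_def by blast
qed

text \<open>
  Choose a second element \<open>f\<close>. The restriction to \<open>{e, f}\<close> is a proper minor because there is a third
  element, and it bounds the marginal of \<open>e\<close> over \<open>{f}\<close> from below by \<open>k - 1\<close>. As \<open>k - 1 \<ge> 2\<close>, the
  element \<open>e\<close> still has rank at least 2 after contracting \<open>f\<close>, and that contraction gives the bound
  over all the other elements.
\<close>

lemma excluded_minor_large_marginal:
  assumes k: "3 \<le> k" and ex: "excluded_minor k (E, \<rho>)" and card: "3 \<le> card E"
    and e: "e \<in> E" "2 \<le> \<rho> {e}"
  shows "int k - 1 \<le> \<rho> E - \<rho> (E - {e})"
proof -
  have "polymatroid (E, \<rho>)" using ex unfolding excluded_minor_def k_polymatroid_def by blast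
  note empty = polymatroidD(2)[OF this]
  have "E \<noteq> {e}" using card by auto
  then obtain f where f: "f \<in> E" "f \<noteq> e" using e by blast
  have "card {e, f} = 2" using f by simp
  then have "E \<noteq> {e, f}" using card by auto
  then have proper: "E - {e, f} \<noteq> {}" using e f by blast
  have pair: "E - (E - {e, f}) - {} = {e, f}" using e f by auto
  have "({e, f}, \<lambda>Z. \<rho> ({} \<union> Z) - \<rho> {}) \<in> P_U24 k"
    using excluded_minor_proper_minor[OF ex, of "E - {e, f}" "{}"] proper unfolding pair by blast
  from binary_natural_matroid_large_marginal[OF this, of e]
  have "int k - 1 \<le> \<rho> {e, f} - \<rho> {f}"
    using e f empty by (simp add: insert_Diff_if)
  moreover have "(E - {} - {f}, \<lambda>Z. \<rho> ({f} \<union> Z) - \<rho> {f}) \<in> P_U24 k"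
    using excluded_minor_proper_minor[OF ex, of "{}" "{f}"] f by blast
  ultimately have "int k - 1 \<le> \<rho> ({f} \<union> (E - {} - {f})) - \<rho> ({f} \<union> (E - {} - {f} - {e}))"
    using binary_natural_matroid_large_marginal[of "E - {} - {f}" "\<lambda>Z. \<rho> ({f} \<union> Z) - \<rho> {f}" k e] e f k
    by (simp add: insert_commute)
  moreover have "{f} \<union> (E - {} - {f}) = E" "{f} \<union> (E - {} - {f} - {e}) = E - {e}" using f by auto
  ultimately show ?thesis by simp
qed

text \<open>
  Only monotonicity of \<open>\<sigma>\<close> is delicate. By submodularity the marginals of an element of \<open>S\<close> are
  smallest over the complement of that element, where they are at least \<open>k - 1\<close>, which pays for the
  amount subtracted. Singletons of \<open>S\<close> drop from at most \<open>k\<close> to at most 1.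
\<close>

lemma excluded_minor_reduces_to_matroid:
  assumes k: "3 \<le> k" and ex: "excluded_minor k (E, \<rho>)" and card: "3 \<le> card E"
    and S: "S = {e \<in> E. 2 \<le> \<rho> {e}}"
    and \<sigma>: "\<And>A. \<sigma> A = \<rho> A - (int k - 1) * int (card (A \<inter> S))"
  shows "k_polymatroid 1 (E, \<sigma>)"
proof -
  have poly: "polymatroid (E, \<rho>)" and le_k: "\<And>e. e \<in> E \<Longrightarrow> \<rho> {e} \<le> int k"
    using ex unfolding excluded_minor_def k_polymatroid_def by auto
  have fin: "finite E" using polymatroidD(1)[OF poly] .
  then have finS: "finite S" unfolding S by simp
  have step: "\<sigma> A \<le> \<sigma> (insert e A)" if eA: "e \<in> E" "A \<subseteq> E" for e A
  proof (cases "e \<in> S \<and> e \<notin> A")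
    case True
    have "\<rho> ((insert e A) \<inter> (E - {e})) + \<rho> ((insert e A) \<union> (E - {e})) \<le> \<rho> (insert e A) + \<rho> (E - {e})"
      using polymatroidD(4)[OF poly, of "insert e A" "E - {e}"] eA by auto
    moreover have "insert e A \<inter> (E - {e}) = A" "insert e A \<union> (E - {e}) = E" using eA True by auto
    ultimately have "int k - 1 \<le> \<rho> (insert e A) - \<rho> A"
      using excluded_minor_large_marginal[OF k ex card, of e] True unfolding S by auto
    moreover have "card (insert e A \<inter> S) = Suc (card (A \<inter> S))"
      using True finS by (simp add: Int_insert_left)
    ultimately show ?thesis unfolding \<sigma> by (simp add: algebra_simps)
  next
    case False
    then have "insert e A \<inter> S = A \<inter> S" by auto
    then show ?thesis unfolding \<sigma> using polymatroidD(3)[OF poly, of A "insert e A"] eA by auto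
  qed
  have mono: "\<sigma> A \<le> \<sigma> B" if AB: "A \<subseteq> B" "B \<subseteq> E" for A B
  proof -
    have "D \<subseteq> E \<Longrightarrow> \<sigma> A \<le> \<sigma> (A \<union> D)" if "finite D" for D
      using that
    proof (induction D rule: finite_induct)
      case empty
      then show ?case by simp
    next
      case (insert d D)
      then have "\<sigma> A \<le> \<sigma> (A \<union> D)" "\<sigma> (A \<union> D) \<le> \<sigma> (insert d (A \<union> D))"
        using step[of d "A \<union> D"] AB by auto
      then show ?case by simp
    qed
    from this[of B] show ?thesis using AB fin finite_subset[of B E] by (simp add: sup.absorb2)
  qed
  have submodular: "\<sigma> (A \<inter> B) + \<sigma> (A \<union> B) \<le> \<sigma> A + \<sigma> B" if "A \<subseteq> E" "B \<subseteq> E" for A B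
  proof -
    have "(A \<inter> S) \<union> (B \<inter> S) = (A \<union> B) \<inter> S" "(A \<inter> S) \<inter> (B \<inter> S) = (A \<inter> B) \<inter> S" by auto
    then have "card (A \<inter> S) + card (B \<inter> S) = card ((A \<union> B) \<inter> S) + card ((A \<inter> B) \<inter> S)"
      using card_Un_Int[of "A \<inter> S" "B \<inter> S"] finS by simp
    then have "int (card (A \<inter> S)) + int (card (B \<inter> S)) = int (card ((A \<union> B) \<inter> S)) + int (card ((A \<inter> B) \<inter> S))"
      by linarith
    then have "(int k - 1) * int (card (A \<inter> S)) + (int k - 1) * int (card (B \<inter> S))
        = (int k - 1) * int (card ((A \<union> B) \<inter> S)) + (int k - 1) * int (card ((A \<inter> B) \<inter> S))"
      by (metis distrib_left)
    then show ?thesis unfolding \<sigma> using polymatroidD(4)[OF poly that] by linarith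
  qed
  have "\<sigma> {e} \<le> 1" if "e \<in> E" for e
    using that le_k[of e] unfolding \<sigma> by (cases "e \<in> S") (auto simp: S)
  then show ?thesis
    using fin mono submodular polymatroidD(2)[OF poly]
    unfolding k_polymatroid_def polymatroid_def by (simp add: \<sigma>)
qed

theorem theorem5p0p1:
  fixes k :: nat
  assumes "k \<ge> 3"
  shows "\<not> (\<exists>P :: 'a ranked_set. excluded_minor k P \<and> card (fst P) = 3)"
proof
  assume "\<exists>P :: 'a ranked_set. excluded_minor k P \<and> card (fst P) = 3"
  then obtain E :: "'a set" and \<rho> where ex: "excluded_minor k (E, \<rho>)" and card: "card E = 3"
    by auto
  define S where "S = {e \<in> E. 2 \<le> \<rho> {e}}"
  define \<sigma> where "\<sigma> A = \<rho> A - (int k - 1) * int (card (A \<inter> S))" for A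
  have "k_polymatroid 1 (E, \<sigma>)"
    using excluded_minor_reduces_to_matroid[OF assms ex _ S_def] card by (simp add: \<sigma>_def)
  then have "binary (E, \<sigma>)" using matroid_card_le_3_binary card by force
  moreover have "finite E" using card by (simp add: card_ge_0_finite)
  ultimately have "binary (natural_matroid k (E, \<rho>))"
    using assms by (intro binary_natural_matroid_of_binary[of E k S \<sigma>]) (auto simp: \<sigma>_def S_def)
  then show False
    using ex unfolding excluded_minor_def P_U24_def by blast
qed

end
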